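(* Let $p$ be an odd prime and let $c$ be an integer. Suppose $c\not\equiv\pm2\pmod{p}$. Let $D_p(c)=\left[(i^2+cij+j^2)^{p-2}\right]_{1\le i,j\le p-1}$. Then the following results hold. (1) Suppose $\left(\frac{c^2-4}{p}\right)=1$. Then $p\mid\det D_p(c)$ if and only if $$cu_k(-c,1)+\left[k(4-c^2)+6-c^2\right]u_{k+1}(-c,1)\equiv0\pmod{p}$$ for some $0\le k\le p-3$. (2) Suppose $\left(\frac{c^2-4}{p}\right)=-1$. Then $p\mid\det D_p(c)$ if and only if $$-cu_k(-c,1)+(2-c^2)u_{k+1}(-c,1)\equiv0\pmod{p}$$ for some $0\le k\le p-3$.
   Context: $\left(\frac{\cdot}{p}\right)$ denotes the Legendre symbol modulo $p$, and $k$ ranges over integers. $D_p(c)$ is the $(p-1)\times(p-1)$ integer matrix whose $(i,j)$ entry is $(i^2+cij+j^2)^{p-2}$, $1\le i,j\le p-1$. For $A,B\in\mathbb{Z}$, the Lucas sequence $u_n(A,B)$ $(n=0,1,2,\ldots)$ is defined by $u_0(A,B)=0$, $u_1(A,B)=1$ and $u_{n+1}(A,B)=Au_n(A,B)-Bu_{n-1}(A,B)$ for $n\ge1$.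
   Formalization: The prime p = 3 is excluded: there c must be divisible by 3, part (1) is vacuous, and part (2) fails, since 3 divides det D_3(c) (e.g. det D_3(0) = -9) while the only allowed k = 0 gives 2 - c^2, which is nonzero mod 3. *)

theory Defs
  imports "Jordan_Normal_Form.Determinant" "HOL-Number_Theory.Number_Theory"
begin

fun lucas_u :: "int \<Rightarrow> int \<Rightarrow> nat \<Rightarrow> int" where
  "lucas_u A B 0 = 0"
| "lucas_u A B (Suc 0) = 1"
| "lucas_u A B (Suc (Suc n)) = A * lucas_u A B (Suc n) - B * lucas_u A B n"

(* Matrix indices start at 0, so position (i, j) holds the entry for (i + 1, j + 1). *)
definition D_mat :: "nat \<Rightarrow> int \<Rightarrow> int mat" where
  "D_mat p c = mat (p - 1) (p - 1)
     (\<lambda>(i, j). ((int (i + 1))\<^sup>2 + c * int (i + 1) * int (j + 1) + (int (j + 1))\<^sup>2) ^ (p - 2))"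

(* The prime 3 has to be excluded from the theorem: there c is divisible by 3, the Legendre symbol
   of c^2 - 4 is -1, and the equivalence fails since only k = 0 is allowed. *)
lemma D_mat_3_counterexample:
  "3 dvd det (D_mat 3 0)"
  "Legendre (0\<^sup>2 - 4) 3 = -1"
  "\<not> (\<exists>k\<le>3 - 3. [- 0 * lucas_u (- 0) 1 k + (2 - 0\<^sup>2) * lucas_u (- 0) 1 (k + 1) = 0] (mod 3))"
proof -
  have "det (D_mat 3 0) = -9"
    by (subst laplace_expansion_column[of _ 2 0])
       (auto simp: D_mat_def cofactor_def det_single mat_delete_def numeral_2_eq_2 lessThan_Suc)
  then show "3 dvd det (D_mat 3 0)"
    by simp
  have "\<not> [y\<^sup>2 = - 4] (mod 3)" for y :: int
  proof -
    have "y mod 3 = 0 \<or> y mod 3 = 1 \<or> y mod 3 = 2"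
      by presburger
    moreover have "y\<^sup>2 mod 3 = (y mod 3)\<^sup>2 mod 3"
      by (simp add: power_mod)
    ultimately show ?thesis
      by (auto simp: cong_def)
  qed
  then show "Legendre (0\<^sup>2 - 4) 3 = -1"
    by (simp add: Legendre_def QuadRes_def cong_def)
  show "\<not> (\<exists>k\<le>3 - 3. [- 0 * lucas_u (- 0) 1 k + (2 - 0\<^sup>2) * lucas_u (- 0) 1 (k + 1) = 0] (mod 3))"
    by (simp add: cong_def)
qed

end

theory Submission
  imports Defs
begin

text \<open>
  Let \<open>n = p - 1\<close> and suppose that \<open>(x\<^sup>2 + c x + 1) ^ (p - 2) = (\<Sum>k<n. b k * x ^ k)\<close> for all nonzero residues
  \<open>x\<close> modulo \<open>p\<close>. Substituting \<open>x = i / j\<close> factors the matrix \<open>D\<close> modulo \<open>p\<close> as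
  \<open>V * diag b * W * diag h\<close> with \<open>V = (i ^ k)\<close>, \<open>W = (j ^ - k)\<close> and \<open>h\<close> free of zeros. Since \<open>V * W = - 1\<close> by
  orthogonality, \<open>p\<close> divides the determinant iff some \<open>b k\<close> vanishes. Finally \<open>(4 - c\<^sup>2) * b k\<close> is the
  expression in Lucas numbers in the statement: multiply the sum by \<open>x\<^sup>2 + c x + 1\<close>, which telescopes because of
  the recurrence, and use \<open>u p = (c\<^sup>2 - 4 | p)\<close> and the corresponding value of \<open>u (p + 1)\<close>. When
  \<open>c\<^sup>2 - 4\<close> is a square, the zeros of \<open>x\<^sup>2 + c x + 1\<close> need a separate evaluation by Binet's formula.
\<close>

section \<open>Truncated generating functions of Lucas sequences\<close>

text \<open>Truncation of the power series identity sum of \<open>u (k + 1) * x ^ k\<close> = 1 / (1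
  - A x + B x^2): the recurrence cancels everything except the two boundary terms.\<close>

lemma lucas_u_genfun:
  fixes A B x :: int
  shows "(1 - A * x + B * x\<^sup>2) * (\<Sum>k<n. lucas_u A B (k + 1) * x ^ k)
    = 1 - lucas_u A B (n + 1) * x ^ n + B * lucas_u A B n * x ^ (n + 1)"
  by (induction n) (simp_all add: algebra_simps power2_eq_square)

text \<open>This is \<open>lucas_u_genfun\<close> after applying the operator x d/dx to both sides
  and rearranging.\<close>

lemma lucas_u_deriv_genfun:
  fixes A B x :: int
  shows "(1 - A * x + B * x\<^sup>2) * (\<Sum>k<n. int k * lucas_u A B (k + 1) * x ^ k)
    = (A * x - 2 * B * x\<^sup>2) * (\<Sum>k<n. lucas_u A B (k + 1) * x ^ k)
      - int n * lucas_u A B (n + 1) * x ^ n + B * (int n + 1) * lucas_u A B n * x ^ (n + 1)"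
  by (induction n) (simp_all add: algebra_simps power2_eq_square)

lemma lucas_u_shift_sum:
  fixes A B x :: int
  shows "(\<Sum>k<n. lucas_u A B k * x ^ k)
    = x * (\<Sum>k<n. lucas_u A B (k + 1) * x ^ k) - lucas_u A B n * x ^ n"
  by (induction n) (simp_all add: algebra_simps)

section \<open>Fermat's theorem over the integers and Lucas numbers at a prime index\<close>

lemma fermat_int:
  fixes x :: int
  assumes "prime p" "\<not> int p dvd x"
  shows "[x ^ (p - 1) = 1] (mod int p)"
proof -
  define y where "y = nat (x mod int p)"
  have p: "p > 0" using assms by (simp add: prime_gt_0_nat)
  have y: "int y = x mod int p" using p by (simp add: y_def)
  have "\<not> p dvd y"
    using assms y by (metis dvd_mod_iff dvd_refl int_dvd_int_iff)
  then have "[y ^ (p - 1) = 1] (mod p)" by (rule fermat_theorem[OF assms(1)])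
  then have "[int y ^ (p - 1) = 1] (mod int p)"
    by (metis cong_int_iff of_nat_1 of_nat_power)
  moreover have "[x ^ (p - 1) = int y ^ (p - 1)] (mod int p)"
    by (intro cong_pow) (simp add: y cong_def)
  ultimately show ?thesis by (rule cong_trans[rotated])
qed


text \<open>Binet's formulas for \<open>u n\<close> and its companion
  \<open>2 * u (n + 1) - A * u n\<close>, with the powers of 2 multiplied out. They are proved
  together because each induction step mixes the two.\<close>

lemma lucas_u_binet:
  fixes A B :: int and s :: complex
  assumes s: "s\<^sup>2 = of_int (A\<^sup>2 - 4 * B)"
  shows "2 ^ n * s * of_int (lucas_u A B n) = (of_int A + s) ^ n - (of_int A - s) ^ n"
    and "2 ^ n * of_int (2 * lucas_u A B (n + 1) - A * lucas_u A B n)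
      = (of_int A + s) ^ n + (of_int A - s) ^ n"
proof (induction n)
  case 0
  show "2 ^ 0 * s * of_int (lucas_u A B 0) = (of_int A + s) ^ 0 - (of_int A - s) ^ 0"
    and "2 ^ 0 * of_int (2 * lucas_u A B (0 + 1) - A * lucas_u A B 0)
      = (of_int A + s) ^ 0 + (of_int A - s) ^ 0"
    by simp_all
next
  case (Suc n)
  let ?P = "(of_int A + s) ^ n - (of_int A - s) ^ n" and ?Q = "(of_int A + s) ^ n + (of_int A - s) ^ n"
  have "(of_int A + s) ^ Suc n - (of_int A - s) ^ Suc n = of_int A * ?P + s * ?Q"
    by (simp add: algebra_simps)
  also have "\<dots> = 2 ^ Suc n * s * of_int (lucas_u A B (Suc n))"
    unfolding Suc[symmetric] by (simp add: algebra_simps)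
  finally show "2 ^ Suc n * s * of_int (lucas_u A B (Suc n)) = (of_int A + s) ^ Suc n - (of_int A - s) ^ Suc n" ..
  have "(of_int A + s) ^ Suc n + (of_int A - s) ^ Suc n = of_int A * ?Q + s * ?P"
    by (simp add: algebra_simps)
  also have "\<dots> = of_int A * ?Q + 2 ^ n * s\<^sup>2 * of_int (lucas_u A B n)"
    unfolding Suc(1)[symmetric] by (simp add: power2_eq_square)
  also have "\<dots> = 2 ^ Suc n * of_int (2 * lucas_u A B (Suc n + 1) - A * lucas_u A B (Suc n))"
    unfolding Suc(2)[symmetric] s by (simp add: algebra_simps power2_eq_square)
  finally show "2 ^ Suc n * of_int (2 * lucas_u A B (Suc n + 1) - A * lucas_u A B (Suc n))
      = (of_int A + s) ^ Suc n + (of_int A - s) ^ Suc n" ..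
qed

text \<open>Expanding Binet's formulas, the difference keeps the odd powers of \<open>s\<close> and
  the sum keeps the even ones. A complex square root exists for either sign of \<open>D\<close>; as
  \<open>s\<close> is nonzero, it cancels and leaves an identity of integers.\<close>

lemma lucas_u_binomial_sums:
  fixes A B :: int
  assumes "A\<^sup>2 - 4 * B \<noteq> 0"
  defines "D \<equiv> A\<^sup>2 - 4 * B"
  shows "2 ^ n * lucas_u A B n
      = 2 * (\<Sum>j\<le>n. if odd j then int (n choose j) * A ^ (n - j) * D ^ (j div 2) else 0)" 
    and "2 ^ n * (2 * lucas_u A B (n + 1) - A * lucas_u A B n)
      = 2 * (\<Sum>j\<le>n. if even j then int (n choose j) * A ^ (n - j) * D ^ (j div 2) else 0)"
proof -
  define s where "s = csqrt (of_int D)"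
  have s2: "s\<^sup>2 = of_int D" by (simp add: s_def)
  have "D \<noteq> 0" using assms by simp
  then have s0: "s \<noteq> 0" by (simp add: s_def)
  let ?t = "\<lambda>j. of_int (int (n choose j) * A ^ (n - j) * D ^ (j div 2)) :: complex"
  have pow: "s ^ j = of_int (D ^ (j div 2)) * (if odd j then s else 1)" for j
  proof -
    have "s ^ j = (s\<^sup>2) ^ (j div 2) * s ^ (j mod 2)"
      by (metis mult_div_mod_eq power_add power_mult)
    then show ?thesis by (auto simp: s2 odd_iff_mod_2_eq_one even_iff_mod_2_eq_zero)
  qed
  have exp_plus: "(of_int A + s) ^ n = (\<Sum>j\<le>n. ?t j * (if odd j then s else 1))"
    by (subst add.commute, subst binomial_ring) (intro sum.cong refl, simp add: pow)
  have exp_minus: "(of_int A - s) ^ n = (\<Sum>j\<le>n. ?t j * (if odd j then - s else 1))"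
  proof -
    have "(of_int A - s) ^ n = (- s + of_int A) ^ n" by simp
    also have "\<dots> = (\<Sum>j\<le>n. of_nat (n choose j) * (- s) ^ j * of_int A ^ (n - j))"
      by (rule binomial_ring)
    also have "\<dots> = (\<Sum>j\<le>n. ?t j * (if odd j then - s else 1))"
      by (intro sum.cong refl) (simp add: pow)
    finally show ?thesis .
  qed
  have "s * of_int (2 ^ n * lucas_u A B n) = (of_int A + s) ^ n - (of_int A - s) ^ n"
    using lucas_u_binet(1)[of s A B n] s2 unfolding D_def by (simp add: mult_ac)
  also have "\<dots> = s * of_int (2 * (\<Sum>j\<le>n. if odd j then int (n choose j) * A ^ (n - j) * D ^ (j div 2) else 0))"
    unfolding exp_plus exp_minus sum_subtractf[symmetric] of_int_mult of_int_sum sum_distrib_left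
    by (intro sum.cong refl) simp
  finally show "2 ^ n * lucas_u A B n
      = 2 * (\<Sum>j\<le>n. if odd j then int (n choose j) * A ^ (n - j) * D ^ (j div 2) else 0)"
    using s0 by (simp only: mult_cancel_left of_int_eq_iff) simp
  have "of_int (2 ^ n * (2 * lucas_u A B (n + 1) - A * lucas_u A B n))
      = (of_int A + s) ^ n + (of_int A - s) ^ n"
    using lucas_u_binet(2)[of s A B n] s2 unfolding D_def by simp
  also have "\<dots> = of_int (2 * (\<Sum>j\<le>n. if even j then int (n choose j) * A ^ (n - j) * D ^ (j div 2) else 0))"
    unfolding exp_plus exp_minus sum.distrib[symmetric] of_int_mult of_int_sum sum_distrib_left
    by (intro sum.cong refl) simp
  finally show "2 ^ n * (2 * lucas_u A B (n + 1) - A * lucas_u A B n)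
      = 2 * (\<Sum>j\<le>n. if even j then int (n choose j) * A ^ (n - j) * D ^ (j div 2) else 0)"
    by (simp only: of_int_eq_iff)
qed

lemma power_prime_cong:
  fixes x :: int
  assumes "prime p"
  shows "[x ^ p = x] (mod int p)"
proof (cases "int p dvd x")
  case True
  moreover have "p > 0" using assms by (simp add: prime_gt_0_nat)
  ultimately have "int p dvd x ^ p" by (simp add: dvd_power_le dvd_trans[OF _ dvd_power])
  with True show ?thesis by (simp add: cong_iff_dvd_diff)
next
  case False
  have "Suc (p - 1) = p" using assms by (simp add: prime_gt_0_nat)
  then have "x ^ p = x * x ^ (p - 1)" by (metis power_Suc)
  also have "[\<dots> = x * 1] (mod int p)" by (intro cong_mult cong_refl fermat_int assms False)
  finally show ?thesis by simp
qed

text \<open>For \<open>n = p\<close> the inner binomial coefficients vanish modulo \<open>p\<close>,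
  so only the terms \<open>j = 0\<close> and \<open>j = p\<close> survive. Euler's criterion
  evaluates the power of the discriminant, and Fermat's theorem turns \<open>2 ^ p\<close> into 2,
  which cancels.\<close>

lemma lucas_u_prime_cong:
  fixes A B :: int
  assumes p: "prime p" "odd p" and "A\<^sup>2 - 4 * B \<noteq> 0"
  shows "[lucas_u A B p = Legendre (A\<^sup>2 - 4 * B) (int p)] (mod int p)"
    and "[2 * lucas_u A B (p + 1) = A * lucas_u A B p + A] (mod int p)"
proof -
  let ?D = "A\<^sup>2 - 4 * B"
  let ?t = "\<lambda>j. int (p choose j) * A ^ (p - j) * ?D ^ (j div 2)"
  have p2: "p > 2" using p prime_ge_2_nat[of p] by (cases "p = 2") auto
  have half: "(p - 1) div 2 = p div 2" using p(2) by (elim oddE) simp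
  have cop: "coprime 2 (int p)" using p by (simp add: coprime_commute)
  have mid: "[?t j = 0] (mod int p)" if "0 < j" "j < p" for j
    using that p by (simp add: cong_0_iff dvd_choose_prime)
  \<comment> \<open>The predicate \<open>P\<close> covers both parities at once: \<open>odd\<close>
    retains the term \<open>j = p\<close>, \<open>even\<close> the term
    \<open>j = 0\<close>.\<close>
  have red: "[(\<Sum>j\<le>p. if P j then ?t j else 0) = (if P p then ?D ^ (p div 2) else 0) + (if P 0 then A ^ p else 0)] (mod int p)"
    for P
  proof -
    have "(\<Sum>j\<le>p. if P j then ?t j else 0) = (\<Sum>j\<in>{0, p} \<union> {1..<p}. if P j then ?t j else 0)"
      using p2 by (intro sum.cong) auto
    also have "\<dots> = (\<Sum>j\<in>{0, p}. if P j then ?t j else 0) + (\<Sum>j\<in>{1..<p}. if P j then ?t j else 0)"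
      by (rule sum.union_disjoint) auto
    also have "(\<Sum>j\<in>{0, p}. if P j then ?t j else 0)
        = (if P p then ?D ^ (p div 2) else 0) + (if P 0 then A ^ p else 0)"
      using p2 by simp
    finally have eq: "(\<Sum>j\<le>p. if P j then ?t j else 0)
        = (if P p then ?D ^ (p div 2) else 0) + (if P 0 then A ^ p else 0)
          + (\<Sum>j\<in>{1..<p}. if P j then ?t j else 0)" .
    have "int p dvd (\<Sum>j\<in>{1..<p}. if P j then ?t j else 0)"
      using mid by (intro dvd_sum) (auto simp: cong_0_iff)
    then show ?thesis
      by (simp only: eq cong_iff_dvd_diff add_diff_cancel_left')
  qed
  have pow2: "[2 * x = 2 ^ p * x] (mod int p)" for x :: int
    using power_prime_cong[OF p(1), of 2] by (intro cong_mult cong_refl) (rule cong_sym)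
  have "[2 * lucas_u A B p = 2 ^ p * lucas_u A B p] (mod int p)" by (rule pow2)
  also have "2 ^ p * lucas_u A B p = 2 * (\<Sum>j\<le>p. if odd j then ?t j else 0)"
    by (rule lucas_u_binomial_sums(1)[OF assms(3)])
  also have "[\<dots> = 2 * ?D ^ (p div 2)] (mod int p)"
    using red[of odd] p by (intro cong_mult cong_refl) simp
  finally have "[lucas_u A B p = ?D ^ (p div 2)] (mod int p)"
    by (simp add: cong_mult_lcancel[OF cop])
  also have "[?D ^ (p div 2) = Legendre ?D (int p)] (mod int p)"
    using euler_criterion[OF p(1) p2, of ?D] half by (simp add: cong_sym)
  finally show "[lucas_u A B p = Legendre ?D (int p)] (mod int p)" .
  let ?v = "2 * lucas_u A B (p + 1) - A * lucas_u A B p"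
  have "[2 * ?v = 2 ^ p * ?v] (mod int p)" by (rule pow2)
  also have "2 ^ p * ?v = 2 * (\<Sum>j\<le>p. if even j then ?t j else 0)"
    by (rule lucas_u_binomial_sums(2)[OF assms(3)])
  also have "[\<dots> = 2 * A ^ p] (mod int p)"
    using red[of even] p by (intro cong_mult cong_refl) simp
  also have "[2 * A ^ p = 2 * A] (mod int p)"
    by (intro cong_mult cong_refl power_prime_cong p)
  finally have "[?v = A] (mod int p)"
    by (simp only: cong_mult_lcancel[OF cop])
  then show "[2 * lucas_u A B (p + 1) = A * lucas_u A B p + A] (mod int p)"
    by (simp add: cong_iff_dvd_diff algebra_simps)
qed


section \<open>Lucas numbers as coefficients of the inverse of x^2 + c x + 1\<close>

text \<open>The assumptions reduce \<open>?q * S\<close> to 2 + c x. Shifting the index multiplies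
  by x up to a boundary term, so the weights \<open>- c\<close> and \<open>2 - c\<^sup>2\<close>
  produce (2 - c^2 - c x) (2 + c x) + c^2 q, in which all powers of x cancel.\<close>

lemma nonresidue_expansion:
  fixes c x m :: int
  assumes u: "[lucas_u (- c) 1 n = c] (mod m)" "[lucas_u (- c) 1 (n + 1) = - 1] (mod m)"
    and x: "[x ^ n = 1] (mod m)"
  shows "[(x\<^sup>2 + c * x + 1) * (\<Sum>k<n. (- c * lucas_u (- c) 1 k + (2 - c\<^sup>2) * lucas_u (- c) 1 (k + 1)) * x ^ k)
    = 4 - c\<^sup>2] (mod m)"
proof -
  let ?u = "lucas_u (- c) 1" and ?q = "x\<^sup>2 + c * x + 1"
  define S where "S = (\<Sum>k<n. ?u (k + 1) * x ^ k)"
  have S: "?q * S = 1 - ?u (n + 1) * x ^ n + ?u n * x ^ n * x"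
    using lucas_u_genfun[of "- c" x 1 n] unfolding S_def by (simp add: algebra_simps)
  have "(\<Sum>k<n. (- c * ?u k + (2 - c\<^sup>2) * ?u (k + 1)) * x ^ k)
      = - c * (\<Sum>k<n. ?u k * x ^ k) + (2 - c\<^sup>2) * S"
    unfolding S_def by (simp add: sum_distrib_left sum.distrib[symmetric] algebra_simps)
  also have "(\<Sum>k<n. ?u k * x ^ k) = x * S - ?u n * x ^ n"
    unfolding S_def by (rule lucas_u_shift_sum)
  also have "?q * (- c * (x * S - ?u n * x ^ n) + (2 - c\<^sup>2) * S)
      = (2 - c\<^sup>2 - c * x) * (?q * S) + c * ?q * (?u n * x ^ n)"
    by (simp add: algebra_simps power2_eq_square)
  finally have eq: "?q * (\<Sum>k<n. (- c * ?u k + (2 - c\<^sup>2) * ?u (k + 1)) * x ^ k)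
      = (2 - c\<^sup>2 - c * x) * (1 - ?u (n + 1) * x ^ n + ?u n * x ^ n * x) + c * ?q * (?u n * x ^ n)"
    unfolding S .
  have "[(2 - c\<^sup>2 - c * x) * (1 - ?u (n + 1) * x ^ n + ?u n * x ^ n * x) + c * ?q * (?u n * x ^ n)
      = (2 - c\<^sup>2 - c * x) * (1 - (- 1) * 1 + c * 1 * x) + c * ?q * (c * 1)] (mod m)"
    by (intro cong_add cong_diff cong_mult cong_refl u x)
  also have "(2 - c\<^sup>2 - c * x) * (1 - (- 1) * 1 + c * 1 * x) + c * ?q * (c * 1) = 4 - c\<^sup>2"
    by (simp add: algebra_simps power2_eq_square)
  finally show ?thesis
    unfolding eq .
qed

text \<open>Here \<open>?q * S\<close> is 0 modulo \<open>m\<close>, so \<open>S\<close> vanishes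
  away from the roots. The constant comes from the differentiated sum \<open>T\<close>: of
  \<open>?q * T\<close> only \<open>- int n * ?u (n + 1) * x ^ n\<close>, which is 1 modulo
  \<open>m\<close>, remains. The weights \<open>c\<close> and \<open>6 - c\<^sup>2\<close> serve to
  make the sum vanish at the roots as well, as \<open>residue_expansion_root\<close> shows.\<close>

lemma residue_expansion_nonroot:
  fixes c x m :: int
  assumes m: "prime m" "\<not> m dvd x\<^sup>2 + c * x + 1"
    and n: "[int n = - 1] (mod m)"
    and u: "[lucas_u (- c) 1 n = 0] (mod m)" "[lucas_u (- c) 1 (n + 1) = 1] (mod m)"
    and x: "[x ^ n = 1] (mod m)"
  shows "[(x\<^sup>2 + c * x + 1) * (\<Sum>k<n. (c * lucas_u (- c) 1 k
      + (int k * (4 - c\<^sup>2) + 6 - c\<^sup>2) * lucas_u (- c) 1 (k + 1)) * x ^ k) = 4 - c\<^sup>2] (mod m)"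
proof -
  let ?u = "lucas_u (- c) 1" and ?q = "x\<^sup>2 + c * x + 1"
  define S where "S = (\<Sum>k<n. ?u (k + 1) * x ^ k)"
  define T where "T = (\<Sum>k<n. int k * ?u (k + 1) * x ^ k)"
  have S: "?q * S = 1 - ?u (n + 1) * x ^ n + ?u n * x ^ n * x"
    using lucas_u_genfun[of "- c" x 1 n] unfolding S_def by (simp add: algebra_simps)
  also have "[\<dots> = 1 - 1 * 1 + 0 * 1 * x] (mod m)"
    by (intro cong_add cong_diff cong_mult cong_refl u x)
  finally have S0: "[S = 0] (mod m)"
    using m by (simp add: cong_0_iff prime_dvd_mult_iff)
  have T: "?q * T = (- c * x - 2 * x\<^sup>2) * S - int n * ?u (n + 1) * x ^ n + (int n + 1) * ?u n * x ^ n * x"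
    using lucas_u_deriv_genfun[of "- c" x 1 n] unfolding S_def T_def by (simp add: algebra_simps)
  have "(\<Sum>k<n. (c * ?u k + (int k * (4 - c\<^sup>2) + 6 - c\<^sup>2) * ?u (k + 1)) * x ^ k)
      = c * (\<Sum>k<n. ?u k * x ^ k) + (4 - c\<^sup>2) * T + (6 - c\<^sup>2) * S"
    unfolding S_def T_def
    by (simp add: sum_distrib_left sum.distrib[symmetric] sum_subtractf[symmetric] algebra_simps)
  also have "(\<Sum>k<n. ?u k * x ^ k) = x * S - ?u n * x ^ n"
    unfolding S_def by (rule lucas_u_shift_sum)
  also have "?q * (c * (x * S - ?u n * x ^ n) + (4 - c\<^sup>2) * T + (6 - c\<^sup>2) * S)
      = ?q * c * (x * S - ?u n * x ^ n) + (4 - c\<^sup>2) * (?q * T) + ?q * (6 - c\<^sup>2) * S"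
    by (simp add: algebra_simps)
  finally have eq: "?q * (\<Sum>k<n. (c * ?u k + (int k * (4 - c\<^sup>2) + 6 - c\<^sup>2) * ?u (k + 1)) * x ^ k)
      = ?q * c * (x * S - ?u n * x ^ n) + (4 - c\<^sup>2) * ((- c * x - 2 * x\<^sup>2) * S
        - int n * ?u (n + 1) * x ^ n + (int n + 1) * ?u n * x ^ n * x) + ?q * (6 - c\<^sup>2) * S"
    unfolding T .
  have "[?q * c * (x * S - ?u n * x ^ n) + (4 - c\<^sup>2) * ((- c * x - 2 * x\<^sup>2) * S
        - int n * ?u (n + 1) * x ^ n + (int n + 1) * ?u n * x ^ n * x) + ?q * (6 - c\<^sup>2) * S
      = ?q * c * (x * 0 - 0 * 1) + (4 - c\<^sup>2) * ((- c * x - 2 * x\<^sup>2) * 0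
        - (- 1) * 1 * 1 + ((- 1) + 1) * 0 * 1 * x) + ?q * (6 - c\<^sup>2) * 0] (mod m)"
    by (intro cong_add cong_diff cong_mult cong_refl u x n S0)
  then show ?thesis
    unfolding eq by simp
qed

lemma sum_index_times_power:
  fixes z :: "'a :: comm_ring_1"
  shows "(z - 1) * (\<Sum>k<n. of_nat k * z ^ k) = of_nat n * z ^ n - z * (\<Sum>k<n. z ^ k)"
  by (induction n) (simp_all add: algebra_simps)

text \<open>Binet's formula modulo \<open>m\<close>: \<open>x\<close> and \<open>y\<close> are the
  roots of t^2 + c t + 1. The factor \<open>x - y\<close> stays on the left to avoid a
  division.\<close>

lemma lucas_u_root_diff:
  fixes c x y m :: int
  assumes "x + y = - c" "[x * y = 1] (mod m)"
  shows "[(x - y) * lucas_u (- c) 1 k = x ^ k - y ^ k] (mod m)"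
proof (induction "- c" "1 :: int" k rule: lucas_u.induct)
  case (3 n)
  have "(x - y) * lucas_u (- c) 1 (Suc (Suc n))
      = (x + y) * ((x - y) * lucas_u (- c) 1 (Suc n)) - 1 * ((x - y) * lucas_u (- c) 1 n)"
    using assms(1) by (simp add: algebra_simps)
  also have "[\<dots> = (x + y) * (x ^ Suc n - y ^ Suc n) - (x * y) * (x ^ n - y ^ n)] (mod m)"
    using 3 assms(2) by (intro cong_diff cong_mult cong_refl) (simp_all add: cong_sym)
  also have "(x + y) * (x ^ Suc n - y ^ Suc n) - (x * y) * (x ^ n - y ^ n) = x ^ Suc (Suc n) - y ^ Suc (Suc n)"
    by (simp add: algebra_simps)
  finally show ?case .
qed simp_all


text \<open>With \<open>y\<close> the other root, multiplication by \<open>x - y\<close> turns each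
  Lucas number into a difference of powers. Since x y = 1, the sum becomes a combination of the
  geometric sum \<open>Z\<close>, its weighted form \<open>T\<close> and the sum \<open>K\<close> of
  the indices, where \<open>z = x\<^sup>2\<close>; all three are known modulo
  \<open>m\<close>.\<close>

lemma residue_expansion_root:
  fixes c x m :: int
  assumes m: "prime m" "\<not> m dvd 2" "\<not> m dvd c\<^sup>2 - 4" "m dvd x\<^sup>2 + c * x + 1"
    and n: "[int n = - 1] (mod m)"
    and x: "[x ^ n = 1] (mod m)"
  shows "m dvd (\<Sum>k<n. (c * lucas_u (- c) 1 k
      + (int k * (4 - c\<^sup>2) + 6 - c\<^sup>2) * lucas_u (- c) 1 (k + 1)) * x ^ k)"
proof -
  let ?u = "lucas_u (- c) 1"
  define y where "y = - c - x"
  define z where "z = x\<^sup>2"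
  define Z where "Z = (\<Sum>k<n. z ^ k)"
  define T where "T = (\<Sum>k<n. int k * z ^ k)"
  define K where "K = (\<Sum>k<n. int k)"
  have xy_sum: "x + y = - c" by (simp add: y_def)
  have "x * y - 1 = - (x\<^sup>2 + c * x + 1)" by (simp add: y_def algebra_simps power2_eq_square)
  then have xy: "[x * y = 1] (mod m)" using m(4) by (simp only: cong_iff_dvd_diff dvd_minus_iff)
  have c: "c = - (x + y)" using xy_sum by simp
  \<comment> \<open>The roots are distinct because the discriminant c^2 - 4 is nonzero modulo
    \<open>m\<close>. Hence \<open>z\<close>, which is the ratio x / y modulo \<open>m\<close>, is
    not 1.\<close>
  have diff: "\<not> m dvd x - y"
  proof
    assume "m dvd x - y"
    then have "m dvd (x - y) * (x - y) + 4 * (x * y - 1)"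
      using xy by (intro dvd_add dvd_mult dvd_mult2) (simp_all add: cong_iff_dvd_diff)
    also have "(x - y) * (x - y) + 4 * (x * y - 1) = c\<^sup>2 - 4"
      by (simp add: c algebra_simps power2_eq_square)
    finally show False using m(3) by simp
  qed
  have z1: "\<not> m dvd z - 1"
  proof
    assume "m dvd z - 1"
    then have "m dvd (z - 1) * y - x * (x * y - 1)"
      using xy unfolding cong_iff_dvd_diff by (intro dvd_diff[OF dvd_mult2 dvd_mult])
    also have "(z - 1) * y - x * (x * y - 1) = x - y"
      by (simp add: z_def algebra_simps power2_eq_square)
    finally show False using diff by simp
  qed
  have zn: "[z ^ n = 1] (mod m)"
    using cong_mult[OF x x] by (simp add: z_def power2_eq_square power_mult_distrib)
  have "m dvd (z - 1) * Z"
    using zn unfolding Z_def power_diff_1_eq[symmetric] by (simp add: cong_iff_dvd_diff)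
  then have Z: "[Z = 0] (mod m)"
    using z1 m(1) by (simp add: cong_0_iff prime_dvd_mult_iff)
  have "(z - 1) * T = int n * z ^ n - z * Z"
    unfolding T_def Z_def using sum_index_times_power[of z n] by simp
  also have "[\<dots> = (- 1) * 1 - z * 0] (mod m)"
    by (intro cong_diff cong_mult cong_refl n zn Z)
  finally have T: "[(z - 1) * T = - 1] (mod m)" by simp
  have "2 * K = int n * (int n - 1)"
    unfolding K_def by (induction n) (simp_all add: algebra_simps)
  also have "[\<dots> = (- 1) * (- 1 - 1)] (mod m)"
    by (intro cong_diff cong_mult cong_refl n)
  finally have "[2 * K = 2 * 1] (mod m)" by simp
  then have K: "[K = 1] (mod m)"
    using prime_imp_coprime[OF m(1,2)] by (simp only: coprime_commute cong_mult_lcancel)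
  let ?a = "\<lambda>k. int k * (4 - c\<^sup>2) + 6 - c\<^sup>2"
  have summand: "[(x - y) * ((c * ?u k + ?a k * ?u (k + 1)) * x ^ k)
      = c * (z ^ k - 1) + ?a k * (x * z ^ k - y)] (mod m)" for k
  proof -
    have "(x - y) * ((c * ?u k + ?a k * ?u (k + 1)) * x ^ k)
        = c * x ^ k * ((x - y) * ?u k) + ?a k * x ^ k * ((x - y) * ?u (k + 1))"
      by (simp add: algebra_simps)
    also have "[\<dots> = c * x ^ k * (x ^ k - y ^ k) + ?a k * x ^ k * (x ^ (k + 1) - y ^ (k + 1))] (mod m)"
      by (intro cong_add cong_mult cong_refl lucas_u_root_diff xy_sum xy)
    also have "c * x ^ k * (x ^ k - y ^ k) + ?a k * x ^ k * (x ^ (k + 1) - y ^ (k + 1))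
        = c * (z ^ k - (x * y) ^ k) + ?a k * (x * z ^ k - y * (x * y) ^ k)"
      by (simp add: z_def algebra_simps power_mult_distrib power2_eq_square)
    also have "[\<dots> = c * (z ^ k - 1 ^ k) + ?a k * (x * z ^ k - y * 1 ^ k)] (mod m)"
      by (intro cong_add cong_diff cong_mult cong_refl cong_pow xy)
    finally show ?thesis by simp
  qed
  have sum_eq: "(\<Sum>k<n. c * (z ^ k - 1) + ?a k * (x * z ^ k - y))
      = c * (Z - int n) + (4 - c\<^sup>2) * (x * T - y * K) + (6 - c\<^sup>2) * (x * Z - int n * y)"
    unfolding Z_def T_def K_def by (induction n) (simp_all add: algebra_simps)
  have "[(x - y) * (\<Sum>k<n. (c * ?u k + ?a k * ?u (k + 1)) * x ^ k)
      = c * (Z - int n) + (4 - c\<^sup>2) * (x * T - y * K) + (6 - c\<^sup>2) * (x * Z - int n * y)] (mod m)"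
    unfolding sum_distrib_left sum_eq[symmetric] by (intro cong_sum summand)
  also have "[c * (Z - int n) + (4 - c\<^sup>2) * (x * T - y * K) + (6 - c\<^sup>2) * (x * Z - int n * y)
      = c * (0 - (- 1)) + (4 - c\<^sup>2) * (x * T - y * 1) + (6 - c\<^sup>2) * (x * 0 - (- 1) * y)] (mod m)"
    by (intro cong_add cong_diff cong_mult cong_refl Z K n)
  \<comment> \<open>Since c^2 = (x - y)^2 + 4 x y and x (x - y) = (z - 1) + (1 - x y), the term (4 -
    c^2) x T splits into multiples of 1 - x y and of (z - 1) T, whose residues are known.\<close>
  also have "c * (0 - (- 1)) + (4 - c\<^sup>2) * (x * T - y * 1) + (6 - c\<^sup>2) * (x * 0 - (- 1) * y)
      = c + 2 * y + 4 * (1 - x * y) * (x * T) - (x - y) * ((z - 1) * T) - (x - y) * (1 - x * y) * T"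
    unfolding c z_def by (simp add: algebra_simps power2_eq_square)
  also have "[\<dots> = c + 2 * y + 4 * (1 - 1) * (x * T) - (x - y) * (- 1) - (x - y) * (1 - 1) * T] (mod m)"
    by (intro cong_add cong_diff cong_mult cong_refl xy T)
  also have "c + 2 * y + 4 * (1 - 1) * (x * T) - (x - y) * (- 1) - (x - y) * (1 - 1) * T = 0"
    using xy_sum by simp
  finally show ?thesis
    using diff m(1) by (simp add: cong_0_iff prime_dvd_mult_iff)
qed

section \<open>The determinant modulo p\<close>

lemma det_cong:
  fixes A B :: "int mat"
  assumes "A \<in> carrier_mat n n" "B \<in> carrier_mat n n"
    and "\<And>i j. i < n \<Longrightarrow> j < n \<Longrightarrow> [A $$ (i, j) = B $$ (i, j)] (mod m)"
  shows "[det A = det B] (mod m)"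
  unfolding det_def'[OF assms(1)] det_def'[OF assms(2)]
  using assms(3) by (intro cong_sum cong_mult cong_refl cong_prod) (auto simp: permutes_in_image)

lemma det_mat_diag: "det (mat_diag n f) = (\<Prod>k<n. f k)"
  by (subst det_upper_triangular[of _ n])
     (auto simp: mat_diag_def upper_triangular_def diag_mat_def prod.list_conv_set_nth atLeast0LessThan)

lemma prime_not_dvd_below:
  assumes "prime p" "i < p - 1"
  shows "\<not> int p dvd int (i + 1)"
  using assms by (metis add.commute int_dvd_int_iff less_diff_conv nat_dvd_not_less plus_1_eq_Suc zero_less_Suc)

lemma power_inverse_cong:
  fixes x :: int
  assumes "prime p" "odd p" "\<not> int p dvd x"
  shows "[x * x ^ (p - 2) = 1] (mod int p)"
proof -
  have "Suc (p - 2) = p - 1" using assms(1,2) prime_ge_2_nat[of p] by (cases "p = 2") auto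
  then have "x * x ^ (p - 2) = x ^ (p - 1)" by (metis power_Suc)
  then show ?thesis using fermat_int[OF assms(1,3)] by simp
qed

text \<open>The unit \<open>w\<close> clears the denominator of the coefficients of the expansion,
  so that \<open>g\<close> is integral. It enters the determinant as \<open>w ^ (p - 1)\<close>,
  which leaves divisibility by \<open>p\<close> unchanged.\<close>

lemma prime_dvd_det_D_mat_iff:
  fixes c w :: int and g :: "nat \<Rightarrow> int"
  assumes p: "prime p" "odd p" and w: "\<not> int p dvd w"
    and expansion: "\<And>x. \<not> int p dvd x \<Longrightarrow>
      [w * (x\<^sup>2 + c * x + 1) ^ (p - 2) = (\<Sum>k<p - 1. g k * x ^ k)] (mod int p)"
  shows "int p dvd det (D_mat p c) \<longleftrightarrow> (\<exists>k<p - 1. int p dvd g k)"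
proof -
  let ?n = "p - 1"
  have pi: "prime (int p)" using p(1) by simp
  \<comment> \<open>\<open>J j\<close> represents the inverse of \<open>j + 1\<close> modulo
    \<open>p\<close>, and \<open>h j\<close> is what remains when the square of \<open>j + 1\<close>
    is taken out of the quadratic form.\<close>
  define J where "J j = int (j + 1) ^ (p - 2)" for j
  define V where "V = mat ?n ?n (\<lambda>(i, k). int (i + 1) ^ k)"
  define W where "W = mat ?n ?n (\<lambda>(k, j). J j ^ k)"
  define h where "h j = ((int (j + 1))\<^sup>2) ^ (p - 2)" for j
  have carrier: "V \<in> carrier_mat ?n ?n" "W \<in> carrier_mat ?n ?n" "D_mat p c \<in> carrier_mat ?n ?n"
    by (auto simp: V_def W_def D_mat_def)
  have J: "[int (j + 1) * J j = 1] (mod int p)" if "j < ?n" for j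
    unfolding J_def by (rule power_inverse_cong[OF p prime_not_dvd_below[OF p(1) that]])
  have nJ: "\<not> int p dvd int (i + 1) * J j" if "i < ?n" "j < ?n" for i j
    using prime_not_dvd_below[OF p(1)] that prime_dvd_power[OF pi]
    unfolding J_def prime_dvd_mult_iff[OF pi] by blast
  have n: "[int ?n = - 1] (mod int p)"
    using prime_gt_0_nat[OF p(1)] by (simp add: cong_iff_dvd_diff of_nat_diff)
  \<comment> \<open>Each entry is a geometric sum with ratio (i + 1) / (j + 1). On the diagonal it
    is \<open>p - 1\<close>; elsewhere the ratio is not 1 but its power \<open>p - 1\<close> is, so
    the sum vanishes.\<close>
  have VW: "[(V * W) $$ (i, j) = (- 1 \<cdot>\<^sub>m 1\<^sub>m ?n) $$ (i, j)] (mod int p)"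
    if ij: "i < ?n" "j < ?n" for i j
  proof -
    let ?x = "int (i + 1) * J j"
    have eq: "(V * W) $$ (i, j) = (\<Sum>k<?n. ?x ^ k)"
      using ij carrier by (simp add: V_def W_def scalar_prod_def atLeast0LessThan power_mult_distrib)
    show ?thesis
    proof (cases "i = j")
      case True
      have "[(\<Sum>k<?n. ?x ^ k) = (\<Sum>k<?n. 1 ^ k)] (mod int p)"
        using J[OF ij(2)] True by (intro cong_sum cong_pow) simp
      with n have "[(\<Sum>k<?n. ?x ^ k) = - 1] (mod int p)"
        by (auto intro: cong_trans)
      then show ?thesis unfolding eq using ij True by simp
    next
      case False
      have "\<not> int p dvd ?x - 1"
      proof
        assume "int p dvd ?x - 1"
        then have "[?x * int (j + 1) = 1 * int (j + 1)] (mod int p)"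
          by (intro cong_mult cong_refl) (simp add: cong_iff_dvd_diff)
        moreover have "[int (i + 1) * (int (j + 1) * J j) = int (i + 1) * 1] (mod int p)"
          by (intro cong_mult cong_refl J ij)
        ultimately have "[int (i + 1) = int (j + 1)] (mod int p)"
          by (simp add: mult_ac) (metis cong_sym cong_trans)
        then have "[i + 1 = j + 1] (mod p)" by (simp only: cong_int_iff)
        then have "i + 1 = j + 1"
          by (rule cong_less_modulus_unique_nat) (use ij in linarith)+
        with False show False by simp
      qed
      moreover have "int p dvd (?x - 1) * (\<Sum>k<?n. ?x ^ k)"
        using fermat_int[OF p(1) nJ[OF ij]] unfolding power_diff_1_eq[symmetric]
        by (simp add: cong_iff_dvd_diff)
      ultimately have "int p dvd (\<Sum>k<?n. ?x ^ k)"
        using p(1) by (simp add: prime_dvd_mult_iff)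
      then show ?thesis unfolding eq using ij False by (simp add: cong_0_iff)
    qed
  qed
  have "[det V * det W = det (- 1 \<cdot>\<^sub>m 1\<^sub>m ?n :: int mat)] (mod int p)"
    unfolding det_mult[OF carrier(1,2), symmetric] using carrier VW by (intro det_cong) auto
  then have "int p dvd det V * det W \<longleftrightarrow> int p dvd (- 1) ^ ?n"
    by (simp add: cong_dvd_iff)
  moreover have "\<not> int p dvd (- 1) ^ ?n"
    using prime_dvd_power[OF pi, of "- 1" ?n] pi not_prime_unit[of "int p"] by auto
  ultimately have units: "\<not> int p dvd det V" "\<not> int p dvd det W"
    by auto

  have "[(w \<cdot>\<^sub>m D_mat p c) $$ (i, j) = (V * (mat_diag ?n g * (W * mat_diag ?n h))) $$ (i, j)] (mod int p)"
    if ij: "i < ?n" "j < ?n" for i j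
  proof -
    let ?i = "int (i + 1)" and ?j = "int (j + 1)"
    let ?x = "?i * J j"
    \<comment> \<open>The factors 1 are placeholders for \<open>?j * J j\<close>; replacing them
      makes \<open>?j\<^sup>2\<close> a common factor and leaves a polynomial in
      \<open>?x\<close>.\<close>
    have "(w \<cdot>\<^sub>m D_mat p c) $$ (i, j) = w * (?i\<^sup>2 * 1 ^ 2 + c * ?i * ?j * 1 + ?j\<^sup>2) ^ (p - 2)"
      using ij by (simp add: D_mat_def)
    also have "[\<dots> = w * (?i\<^sup>2 * (?j * J j) ^ 2 + c * ?i * ?j * (?j * J j) + ?j\<^sup>2) ^ (p - 2)] (mod int p)"
      using J[OF ij(2)] by (intro cong_mult cong_add cong_pow cong_refl) (rule cong_sym, assumption)+
    also have "w * (?i\<^sup>2 * (?j * J j) ^ 2 + c * ?i * ?j * (?j * J j) + ?j\<^sup>2) ^ (p - 2)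
        = w * (?j\<^sup>2 * (?x\<^sup>2 + c * ?x + 1)) ^ (p - 2)"
      by (simp add: algebra_simps power2_eq_square)
    also have "\<dots> = h j * (w * (?x\<^sup>2 + c * ?x + 1) ^ (p - 2))"
      by (simp only: h_def power_mult_distrib mult_ac)
    also have "[\<dots> = h j * (\<Sum>k<?n. g k * ?x ^ k)] (mod int p)"
      by (intro cong_mult cong_refl expansion nJ ij)
    also have "h j * (\<Sum>k<?n. g k * ?x ^ k) = (V * (mat_diag ?n g * (W * mat_diag ?n h))) $$ (i, j)"
      using ij carrier unfolding mat_diag_mult_right[OF carrier(2)]
      by (subst mat_diag_mult_left[of _ _ ?n])
         (simp_all add: V_def W_def scalar_prod_def atLeast0LessThan power_mult_distrib
           sum_distrib_left mult_ac)
    finally show ?thesis .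
  qed
  then have "[det (w \<cdot>\<^sub>m D_mat p c) = det (V * (mat_diag ?n g * (W * mat_diag ?n h)))] (mod int p)"
    using carrier by (intro det_cong[of _ ?n]) (auto intro!: mult_carrier_mat)
  also have "det (V * (mat_diag ?n g * (W * mat_diag ?n h)))
      = det V * ((\<Prod>k<?n. g k) * (det W * (\<Prod>k<?n. h k)))"
    unfolding det_mult[OF carrier(1) mult_carrier_mat[OF mat_diag_dim mult_carrier_mat[OF carrier(2) mat_diag_dim]]]
      det_mult[OF mat_diag_dim mult_carrier_mat[OF carrier(2) mat_diag_dim]]
      det_mult[OF carrier(2) mat_diag_dim] det_mat_diag ..
  finally have "int p dvd w ^ ?n * det (D_mat p c)
      \<longleftrightarrow> int p dvd det V * ((\<Prod>k<?n. g k) * (det W * (\<Prod>k<?n. h k)))"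
    using carrier(3) by (simp add: cong_dvd_iff)
  moreover have "\<not> int p dvd (\<Prod>k<?n. h k)"
    using prime_not_dvd_below[OF p(1)] prime_dvd_power[OF pi] unfolding h_def
    by (subst prime_dvd_prod_iff[OF _ pi]) blast+
  moreover have "\<not> int p dvd w ^ ?n"
    using w prime_dvd_power[OF pi] by blast
  ultimately show ?thesis
    using units p(1) by (auto simp: prime_dvd_mult_iff prime_dvd_prod_iff)
qed


section \<open>From the expansion to the criterion\<close>

text \<open>Modulo \<open>p\<close>, the power \<open>q ^ (p - 2)\<close> is the inverse of a unit
  \<open>q\<close>, and it is 0 at a zero \<open>q\<close> because \<open>p - 2\<close> is
  positive.\<close>

lemma prime_power_inverse_expansion:
  fixes q w G :: int
  assumes p: "prime p" "odd p"
    and "\<not> int p dvd q \<Longrightarrow> [q * G = w] (mod int p)" and "int p dvd q \<Longrightarrow> int p dvd G"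
  shows "[w * q ^ (p - 2) = G] (mod int p)"
proof (cases "int p dvd q")
  case True
  have "p - 2 > 0" using p prime_ge_2_nat[of p] by (cases "p = 2") auto
  with True have "int p dvd q ^ (p - 2)" by (meson dvd_power dvd_trans)
  with assms(4)[OF True] show ?thesis by (simp add: cong_iff_dvd_diff)
next
  case False
  have "[w * q ^ (p - 2) = q * G * q ^ (p - 2)] (mod int p)"
    by (intro cong_mult cong_refl cong_sym[OF assms(3)] False)
  also have "q * G * q ^ (p - 2) = G * (q * q ^ (p - 2))" by simp
  also have "[\<dots> = G * 1] (mod int p)"
    by (intro cong_mult cong_refl power_inverse_cong p False)
  finally show ?thesis by simp
qed

theorem theorem1p3:
  fixes p :: nat and c :: int
  assumes "prime p" and "odd p"
    and "p \<noteq> 3"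
    and "\<not> [c = 2] (mod (int p))" and "\<not> [c = -2] (mod (int p))"
  shows "(Legendre (c\<^sup>2 - 4) (int p) = 1 \<longrightarrow>
            (int p dvd det (D_mat p c) \<longleftrightarrow>
              (\<exists>k\<le>p - 3. [c * lucas_u (- c) 1 k
                 + (int k * (4 - c\<^sup>2) + 6 - c\<^sup>2) * lucas_u (- c) 1 (k + 1) = 0] (mod (int p)))))
       \<and> (Legendre (c\<^sup>2 - 4) (int p) = -1 \<longrightarrow>
            (int p dvd det (D_mat p c) \<longleftrightarrow>
              (\<exists>k\<le>p - 3. [- c * lucas_u (- c) 1 k
                 + (2 - c\<^sup>2) * lucas_u (- c) 1 (k + 1) = 0] (mod (int p)))))"
proof (intro conjI impI)
  let ?u = "lucas_u (- c) 1" and ?n = "p - 1" and ?m = "int p"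
  note p = assms(1,2)
  have p5: "p \<ge> 5"
  proof -
    have "p \<noteq> 2" "p \<noteq> 4" using p(2) by auto
    then show ?thesis using prime_ge_2_nat[OF p(1)] assms(3) by linarith
  qed
  have pi: "prime ?m" using p(1) by simp
  have two: "\<not> ?m dvd 2" using p5 by (auto dest: zdvd_imp_le)
  have "\<not> ?m dvd (c - 2) * (c - (- 2))"
    using assms(4,5) unfolding prime_dvd_mult_iff[OF pi] cong_iff_dvd_diff by blast
  also have "(c - 2) * (c - (- 2)) = c\<^sup>2 - 4"
    by (simp add: algebra_simps power2_eq_square)
  finally have D: "\<not> ?m dvd c\<^sup>2 - 4" .
  then have w: "\<not> ?m dvd 4 - c\<^sup>2" by (simp only: dvd_diff_commute not_False_eq_True)
  have D0: "(- c)\<^sup>2 - 4 * 1 \<noteq> 0" using D by auto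
  have n: "[int ?n = - 1] (mod ?m)" using p5 by (simp add: cong_iff_dvd_diff of_nat_diff)
  have index: "?n + 1 = p" "p - 2 + 1 = ?n" "Suc ?n = p" "Suc (p - 2) = ?n"
    using p5 by auto
  have u_p2: "?u (p - 2) = - c * ?u ?n - ?u p"
    using lucas_u.simps(3)[of "- c" 1 "p - 2"] unfolding index by simp
  \<comment> \<open>Running the recurrence backwards from the indices \<open>p + 1\<close> and
    \<open>p\<close> gives \<open>?u ?n\<close>. It appears doubled since
    \<open>lucas_u_prime_cong\<close> yields twice \<open>?u (p + 1)\<close>.\<close>
  have u_n: "[?u ?n + ?u ?n = c * (1 - Legendre (c\<^sup>2 - 4) ?m)] (mod ?m)"
    and u_p: "[?u p = Legendre (c\<^sup>2 - 4) ?m] (mod ?m)"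
  proof -
    show up: "[?u p = Legendre (c\<^sup>2 - 4) ?m] (mod ?m)"
      using lucas_u_prime_cong(1)[OF p D0] by simp
    have "?u (p + 1) = - c * ?u p - ?u ?n"
      using lucas_u.simps(3)[of "- c" 1 ?n] unfolding index by simp
    then have "?u ?n + ?u ?n = - 2 * c * ?u p - 2 * ?u (p + 1)" by simp
    also have "[\<dots> = - 2 * c * Legendre (c\<^sup>2 - 4) ?m - (- c * ?u p + (- c))] (mod ?m)"
      by (intro cong_diff cong_mult cong_refl up lucas_u_prime_cong(2)[OF p D0])
    also have "[- 2 * c * Legendre (c\<^sup>2 - 4) ?m - (- c * ?u p + (- c))
      = - 2 * c * Legendre (c\<^sup>2 - 4) ?m - (- c * Legendre (c\<^sup>2 - 4) ?m + (- c))] (mod ?m)"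
      by (intro cong_diff cong_add cong_mult cong_refl up)
    finally show "[?u ?n + ?u ?n = c * (1 - Legendre (c\<^sup>2 - 4) ?m)] (mod ?m)"
      by (simp add: algebra_simps)
  qed
  \<comment> \<open>The last coefficient is \<open>\<plusminus>c\<close>, and if it vanishes then so does the coefficient of index 1; this is why
    the range of the index can be cut down by one, provided that \<open>p > 3\<close>.\<close>
  have main: "?m dvd det (D_mat p c) \<longleftrightarrow> (\<exists>k\<le>p - 3. [g k = 0] (mod ?m))"
    if "\<And>x. \<not> ?m dvd x \<Longrightarrow>
        [(4 - c\<^sup>2) * (x\<^sup>2 + c * x + 1) ^ (p - 2) = (\<Sum>k<?n. g k * x ^ k)] (mod ?m)"
      and last: "[g (p - 2) = e * c] (mod ?m)" "\<bar>e\<bar> = 1" and one: "c dvd g 1" for g e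
  proof -
    have "?m dvd g 1" if "?m dvd g (p - 2)"
    proof -
      from that last(1) have "?m dvd e * c" by (simp only: cong_dvd_iff)
      with last(2) have "?m dvd c" by (auto simp: abs_if split: if_splits)
      with one show ?thesis by (rule dvd_trans[rotated])
    qed
    moreover have "k < ?n \<longleftrightarrow> k \<le> p - 3 \<or> k = p - 2" for k using p5 by auto
    moreover have "1 \<le> p - 3" using p5 by auto
    ultimately have "(\<exists>k<?n. ?m dvd g k) \<longleftrightarrow> (\<exists>k\<le>p - 3. ?m dvd g k)" by metis
    with prime_dvd_det_D_mat_iff[OF p w that(1)] show ?thesis
      unfolding cong_0_iff by simp
  qed
  note power_n = fermat_int[OF p(1)]
  {
    assume L: "Legendre (c\<^sup>2 - 4) ?m = 1"
    let ?g = "\<lambda>k. c * ?u k + (int k * (4 - c\<^sup>2) + 6 - c\<^sup>2) * ?u (k + 1)"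
    have "?m dvd 2 * ?u ?n" using u_n L by (simp add: cong_0_iff)
    then have un: "[?u ?n = 0] (mod ?m)"
      using two unfolding prime_dvd_mult_iff[OF pi] cong_0_iff by blast
    have up: "[?u p = 1] (mod ?m)" using u_p L by simp
    then have un1: "[?u (?n + 1) = 1] (mod ?m)" unfolding index(1) .
    show "?m dvd det (D_mat p c) \<longleftrightarrow> (\<exists>k\<le>p - 3. [?g k = 0] (mod ?m))"
    proof (rule main[where e = "- 1"])
      fix x :: int
      assume x: "\<not> ?m dvd x"
      show "[(4 - c\<^sup>2) * (x\<^sup>2 + c * x + 1) ^ (p - 2) = (\<Sum>k<?n. ?g k * x ^ k)] (mod ?m)"
        using residue_expansion_nonroot[OF pi _ n un un1 power_n[OF x]]
          residue_expansion_root[OF pi two D _ n power_n[OF x]]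
        by (intro prime_power_inverse_expansion p)
    next
      have "?g (p - 2) = c * (- c * ?u ?n - ?u p) + (int (p - 2) * (4 - c\<^sup>2) + 6 - c\<^sup>2) * ?u ?n"
        unfolding index(2) u_p2 ..
      also have "[\<dots> = c * (- c * 0 - 1) + (int (p - 2) * (4 - c\<^sup>2) + 6 - c\<^sup>2) * 0] (mod ?m)"
        by (intro cong_add cong_diff cong_mult cong_refl un up)
      finally show "[?g (p - 2) = - 1 * c] (mod ?m)" by simp
    \<comment> \<open>As \<open>?u 1 = 1\<close> and \<open>?u 2 = - c\<close>, both terms of
      \<open>?g 1\<close> are multiples of \<open>c\<close>.\<close>
    qed (simp_all add: numeral_2_eq_2)
  next
    assume L: "Legendre (c\<^sup>2 - 4) ?m = - 1"
    let ?g = "\<lambda>k. - c * ?u k + (2 - c\<^sup>2) * ?u (k + 1)"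
    have "?m dvd 2 * (?u ?n - c)" using u_n L by (simp add: cong_iff_dvd_diff algebra_simps)
    then have un: "[?u ?n = c] (mod ?m)"
      using two unfolding prime_dvd_mult_iff[OF pi] cong_iff_dvd_diff by blast
    have up: "[?u p = - 1] (mod ?m)" using u_p L by simp
    then have un1: "[?u (?n + 1) = - 1] (mod ?m)" unfolding index(1) .
    show "?m dvd det (D_mat p c) \<longleftrightarrow> (\<exists>k\<le>p - 3. [?g k = 0] (mod ?m))"
    proof (rule main[where e = 1])
      fix x :: int
      assume x: "\<not> ?m dvd x"
      have "[(x\<^sup>2 + c * x + 1) * (\<Sum>k<?n. ?g k * x ^ k) = 4 - c\<^sup>2] (mod ?m)"
        by (rule nonresidue_expansion[OF un un1 power_n[OF x]])
      \<comment> \<open>The quadratic has no zero modulo \<open>p\<close> in this case: by the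
        congruence just shown, \<open>p\<close> would then divide
        \<open>4 - c\<^sup>2\<close>.\<close>
      then show "[(4 - c\<^sup>2) * (x\<^sup>2 + c * x + 1) ^ (p - 2) = (\<Sum>k<?n. ?g k * x ^ k)] (mod ?m)"
        using w by (intro prime_power_inverse_expansion p) (auto dest: cong_dvd_iff)
    next
      have "?g (p - 2) = - c * (- c * ?u ?n - ?u p) + (2 - c\<^sup>2) * ?u ?n"
        unfolding index(2) u_p2 ..
      also have "[\<dots> = - c * (- c * c - (- 1)) + (2 - c\<^sup>2) * c] (mod ?m)"
        by (intro cong_add cong_diff cong_mult cong_refl un up)
      also have "- c * (- c * c - (- 1)) + (2 - c\<^sup>2) * c = 1 * c"
        by (simp add: algebra_simps power2_eq_square)
      finally show "[?g (p - 2) = 1 * c] (mod ?m)" .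
    qed (simp_all add: numeral_2_eq_2)
  }
qed

end
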